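(* Let $a<b$ and $c<d$ be real numbers, let $\Delta := [a,b]\times[c,d]\subset\mathbb{R}^2$, and let $f:\Delta\to\mathbb{R}$ be a partial differentiable mapping on $\Delta$. If $\left|\dfrac{\partial^2 f}{\partial t\partial s}\right|$ is a convex function on the co-ordinates on $\Delta$, then $$\left|\frac{f(a,c)+f(a,d)+f(b,c)+f(b,d)}{4}+\frac{1}{(b-a)(d-c)}\int_a^b\int_c^d f(x,y)\,dy\,dx-A\right|$$ $$\le\frac{(b-a)(d-c)}{16}\left(\frac{\left|\frac{\partial^2 f}{\partial t\partial s}(a,c)\right|+\left|\frac{\partial^2 f}{\partial t\partial s}(a,d)\right|+\left|\frac{\partial^2 f}{\partial t\partial s}(b,c)\right|+\left|\frac{\partial^2 f}{\partial t\partial s}(b,d)\right|}{4}\right),$$ where $$A=\frac12\left[\frac{1}{b-a}\int_a^b\left[f(x,c)+f(x,d)\right]dx+\frac{1}{d-c}\int_c^d\left[f(a,y)+f(b,y)\right]dy\right].$$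
   Context: "Partial differentiable mapping on $\Delta$" means that the first-order partial derivatives of $f$ and the mixed second-order partial derivative $\frac{\partial^2 f}{\partial t\partial s}$ exist at every point of $\Delta$ (one-sided derivatives being used at the boundary). Here $\frac{\partial^2 f}{\partial t\partial s}$ denotes the mixed partial derivative of $f$ with respect to its own two variables ($t$ standing for the first variable and $s$ for the second): $f$ is differentiated first in the second variable, then in the first. A function $g:\Delta\to\mathbb{R}$ is convex on the co-ordinates (co-ordinated convex) on $\Delta$ if for all $t,s\in[0,1]$, all $x,y\in[a,b]$ and all $u,v\in[c,d]$, $$g(tx+(1-t)y,\,su+(1-s)v)\le ts\,g(x,u)+s(1-t)\,g(y,u)+t(1-s)\,g(x,v)+(1-t)(1-s)\,g(y,v).$$ Equivalently, the partial mappings $u\mapsto g(u,y)$ on $[a,b]$ and $v\mapsto g(x,v)$ on $[c,d]$ are convex for all $y\in[c,d]$ and $x\in[a,b]$. *)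

theory Defs
  imports "HOL-Analysis.Analysis"
begin

text \<open>
  Functions on a rectangle \<open>I \<times> J\<close> (in practice \<open>I = {a..b}\<close>, \<open>J = {c..d}\<close> with \<open>a < b\<close>, \<open>c < d\<close>)
  are total functions on \<open>real \<times> real\<close> of which only the values on \<open>I \<times> J\<close> matter.
  All derivatives are taken within \<open>I\<close> or \<open>J\<close>: this yields two-sided derivatives at
  interior points and one-sided derivatives at the boundary, and does not see the values
  outside the rectangle.
\<close>

definition partial1 :: "real set \<Rightarrow> (real \<times> real \<Rightarrow> real) \<Rightarrow> real \<times> real \<Rightarrow> real" where
  "partial1 I f = (\<lambda>(x, y). vector_derivative (\<lambda>t. f (t, y)) (at x within I))"

definition partial2 :: "real set \<Rightarrow> (real \<times> real \<Rightarrow> real) \<Rightarrow> real \<times> real \<Rightarrow> real" where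
  "partial2 J f = (\<lambda>(x, y). vector_derivative (\<lambda>s. f (x, s)) (at y within J))"

definition partial1_exists_on ::
  "real set \<Rightarrow> real set \<Rightarrow> (real \<times> real \<Rightarrow> real) \<Rightarrow> bool" where
  "partial1_exists_on I J f \<longleftrightarrow>
     (\<forall>x\<in>I. \<forall>y\<in>J. (\<lambda>t. f (t, y)) differentiable (at x within I))"

definition partial2_exists_on ::
  "real set \<Rightarrow> real set \<Rightarrow> (real \<times> real \<Rightarrow> real) \<Rightarrow> bool" where
  "partial2_exists_on I J f \<longleftrightarrow>
     (\<forall>x\<in>I. \<forall>y\<in>J. (\<lambda>s. f (x, s)) differentiable (at y within J))"

text \<open>The mixed derivative: first in the second variable, then in the first.\<close>

definition mixed_partial ::
  "real set \<Rightarrow> real set \<Rightarrow> (real \<times> real \<Rightarrow> real) \<Rightarrow> real \<times> real \<Rightarrow> real" where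
  "mixed_partial I J f = partial1 I (partial2 J f)"

definition partial_differentiable_on ::
  "real set \<Rightarrow> real set \<Rightarrow> (real \<times> real \<Rightarrow> real) \<Rightarrow> bool" where
  "partial_differentiable_on I J f \<longleftrightarrow>
     partial1_exists_on I J f \<and> partial2_exists_on I J f \<and>
     partial1_exists_on I J (partial2 J f)"

definition coord_convex_on ::
  "real set \<Rightarrow> real set \<Rightarrow> (real \<times> real \<Rightarrow> real) \<Rightarrow> bool" where
  "coord_convex_on I J g \<longleftrightarrow>
     (\<forall>t\<in>{0..1}. \<forall>s\<in>{0..1}. \<forall>x\<in>I. \<forall>y\<in>I. \<forall>u\<in>J. \<forall>v\<in>J.
        g (t * x + (1 - t) * y, s * u + (1 - s) * v)
          \<le> t * s * g (x, u) + s * (1 - t) * g (y, u)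
            + t * (1 - s) * g (x, v) + (1 - t) * (1 - s) * g (y, v))"

end

theory Submission imports Defs
begin

text \<open>
  For a differentiable \<open>\<phi>\<close> on \<open>[a, b]\<close> with midpoint \<open>m\<close>, integrating the derivative of
  \<open>(x - m) \<phi>(x)\<close> writes the trapezoid error of \<open>\<phi>\<close> as the mean of \<open>(x - m) \<phi>'(x)\<close>, so a linear
  bound on \<open>\<bar>\<phi>'\<bar>\<close> with end values \<open>P\<close>, \<open>Q\<close> bounds that error by \<open>(b - a) (P + Q) / 8\<close>.

  The left-hand side of the theorem is the trapezoid error in \<open>y\<close> of \<open>G y\<close>, the trapezoid error in
  \<open>x\<close> of \<open>f (\<cdot>, y)\<close>. The derivative \<open>G' y\<close> is the trapezoid error of \<open>\<partial>f/\<partial>y (\<cdot>, y)\<close>, which the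
  one-variable estimate bounds in terms of the mixed derivative; by convexity this bound is linear
  in \<open>y\<close>, and the one-variable estimate applies again.

  Convexity also makes the mixed derivative bounded. Hence the increments
  \<open>f (x, y) - f (x', y)\<close> are Lipschitz in \<open>y\<close>, with a constant proportional to \<open>\<bar>x - x'\<bar>\<close>; this
  gives joint continuity of \<open>f\<close> and the domination needed to differentiate under the integral.
\<close>

section \<open>The trapezoid rule in one variable\<close>

definition trapezoid_error :: "real \<Rightarrow> real \<Rightarrow> (real \<Rightarrow> real) \<Rightarrow> real" where
  "trapezoid_error a b \<phi> = (\<phi> a + \<phi> b) / 2 - 1 / (b - a) * integral {a..b} \<phi>"

text \<open>Around the midpoint \<open>m\<close> the linear factor is
  \<open>K + B * (x - m)\<close>. The odd part integrates to zero against
  \<open>\<bar>x - m\<bar>\<close>, and \<open>K\<close> is multiplied by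
  \<open>(b - a)\<^sup>2 / 4\<close>. Splitting at \<open>m\<close> removes the absolute value and
  leaves the antiderivative \<open>T\<close>.\<close>

lemma has_integral_abs_centered_linear:
  fixes a b P Q :: real
  assumes "a < b"
  shows "((\<lambda>x. \<bar>x - (a + b) / 2\<bar> * (((b - x) * P + (x - a) * Q) / (b - a)))
           has_integral (b - a)\<^sup>2 / 8 * (P + Q)) {a..b}"
proof -
  define m where "m = (a + b) / 2"
  define K where "K = (P + Q) / 2"
  define B where "B = (Q - P) / (b - a)"
  define T where "T = (\<lambda>x. K * (x - m)\<^sup>2 / 2 + B * (x - m) ^ 3 / 3)"
  have m: "a \<le> m" "m \<le> b" and ends: "a - m = - ((b - a) / 2)" "b - m = (b - a) / 2"
    using assms by (auto simp: m_def field_simps)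
  have lin: "((b - x) * P + (x - a) * Q) / (b - a) = K + B * (x - m)" for x
    using assms by (simp add: K_def B_def m_def field_simps)
  have dT: "(T has_vector_derivative (x - m) * (K + B * (x - m))) (at x within S)" for x S
    unfolding T_def has_real_derivative_iff_has_vector_derivative[symmetric]
    by (auto intro!: derivative_eq_intros simp: field_simps power2_eq_square)
  have "((\<lambda>x. - ((x - m) * (K + B * (x - m)))) has_integral - (T m - T a)) {a..m}"
    by (intro has_integral_neg fundamental_theorem_of_calculus m dT)
  then have left: "((\<lambda>x. \<bar>x - m\<bar> * (K + B * (x - m))) has_integral - (T m - T a)) {a..m}"
    by (rule has_integral_eq[rotated]) (auto simp: algebra_simps)
  have "((\<lambda>x. (x - m) * (K + B * (x - m))) has_integral (T b - T m)) {m..b}"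
    by (intro fundamental_theorem_of_calculus m dT)
  then have right: "((\<lambda>x. \<bar>x - m\<bar> * (K + B * (x - m))) has_integral (T b - T m)) {m..b}"
    by (rule has_integral_eq[rotated]) auto
  have "- (T m - T a) + (T b - T m) = (b - a)\<^sup>2 / 8 * (P + Q)"
    unfolding T_def ends K_def by (simp add: power2_eq_square power3_eq_cube field_simps)
  then show ?thesis
    using has_integral_combine[OF m left right] unfolding lin m_def[symmetric] by (simp only:)
qed

lemma has_integral_norm_le:
  fixes \<phi> :: "'a::euclidean_space \<Rightarrow> 'b::euclidean_space"
  assumes "(\<phi> has_integral i) S" "(\<psi> has_integral j) S"
    and "\<And>x. x \<in> S \<Longrightarrow> norm (\<phi> x) \<le> \<psi> x"
  shows "norm i \<le> j"
  using integral_norm_bound_integral[of \<phi> S \<psi>] assms by (auto simp: has_integral_iff)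

lemma trapezoid_error_le:
  fixes a b P Q :: real
  assumes "a < b"
    and deriv: "\<And>x. x \<in> {a..b} \<Longrightarrow> (\<phi> has_real_derivative \<phi>' x) (at x within {a..b})"
    and bound: "\<And>x. x \<in> {a..b} \<Longrightarrow> \<bar>\<phi>' x\<bar> \<le> ((b - x) * P + (x - a) * Q) / (b - a)"
  shows "\<bar>trapezoid_error a b \<phi>\<bar> \<le> (b - a) / 8 * (P + Q)"
proof -
  define m where "m = (a + b) / 2"
  have "continuous_on {a..b} \<phi>"
    using deriv by (rule DERIV_continuous_on)
  then have int: "(\<phi> has_integral integral {a..b} \<phi>) {a..b}"
    by (simp add: integrable_continuous_real integrable_integral)
  \<comment> \<open>\<open>has_integral\<close> is the gauge integral, which integrates every
    derivative, so this covers a discontinuous \<open>\<phi>'\<close>.\<close>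
  have "((\<lambda>x. (x - m) * \<phi>' x + \<phi> x) has_integral (b - m) * \<phi> b - (a - m) * \<phi> a) {a..b}"
  proof (rule fundamental_theorem_of_calculus)
    fix x assume "x \<in> {a..b}"
    then show "((\<lambda>x. (x - m) * \<phi> x) has_vector_derivative (x - m) * \<phi>' x + \<phi> x)
        (at x within {a..b})"
      unfolding has_real_derivative_iff_has_vector_derivative[symmetric]
      by (auto intro!: derivative_eq_intros deriv)
  qed (use assms in simp)
  moreover have "(b - m) * \<phi> b - (a - m) * \<phi> a - integral {a..b} \<phi> =
      (b - a) * trapezoid_error a b \<phi>"
    using assms(1) unfolding trapezoid_error_def m_def by (simp add: divide_simps) algebra
  ultimately have "((\<lambda>x. (x - m) * \<phi>' x) has_integral (b - a) * trapezoid_error a b \<phi>) {a..b}"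
    using has_integral_diff[OF _ int] by fastforce
  then have "norm ((b - a) * trapezoid_error a b \<phi>) \<le> (b - a)\<^sup>2 / 8 * (P + Q)"
    by (rule has_integral_norm_le[OF _ has_integral_abs_centered_linear[OF assms(1), folded m_def]])
      (unfold real_norm_def abs_mult, intro mult_left_mono bound, auto)
  then have "(b - a) * \<bar>trapezoid_error a b \<phi>\<bar> \<le> (b - a) * ((b - a) / 8 * (P + Q))"
    using assms(1) by (simp add: abs_mult power2_eq_square)
  then show ?thesis
    using assms(1) by (simp only: mult_le_cancel_left_pos[of "b - a"] diff_gt_0_iff_gt)
qed

section \<open>Regularity and the iterated trapezoid error under a bound on the mixed
  derivative\<close>

locale bounded_mixed_derivative =
  fixes a b c d M :: real and f g h :: "real \<Rightarrow> real \<Rightarrow> real"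
  assumes ab: "a < b" and cd: "c < d"
    and cont1: "continuous_on {a..b} (\<lambda>x. f x c)"
    and deriv2: "\<And>x y. x \<in> {a..b} \<Longrightarrow> y \<in> {c..d} \<Longrightarrow>
      (f x has_real_derivative g x y) (at y within {c..d})"
    and deriv12: "\<And>x y. x \<in> {a..b} \<Longrightarrow> y \<in> {c..d} \<Longrightarrow>
      ((\<lambda>t. g t y) has_real_derivative h x y) (at x within {a..b})"
    and bound: "\<And>x y. x \<in> {a..b} \<Longrightarrow> y \<in> {c..d} \<Longrightarrow> \<bar>h x y\<bar> \<le> M"
begin

text \<open>The mean value inequality is applied twice: in \<open>x\<close> to \<open>g\<close>,
  then in \<open>y\<close> to \<open>f x - f x'\<close>, whose derivative \<open>g x - g x'\<close>
  has just been bounded.\<close>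

lemma increment_bound:
  assumes "x \<in> {a..b}" "x' \<in> {a..b}" "y \<in> {c..d}" "y' \<in> {c..d}"
  shows "\<bar>(f x y - f x' y) - (f x y' - f x' y')\<bar> \<le> M * \<bar>x - x'\<bar> * \<bar>y - y'\<bar>"
proof -
  have g: "\<bar>g x s - g x' s\<bar> \<le> M * \<bar>x - x'\<bar>" if "s \<in> {c..d}" for s
    using field_differentiable_bound[of "{a..b}" "\<lambda>t. g t s" "\<lambda>t. h t s" M x x'] deriv12 bound
      assms that by auto
  show ?thesis
    using field_differentiable_bound[of "{c..d}" "\<lambda>s. f x s - f x' s" "\<lambda>s. g x s - g x' s"
        "M * \<bar>x - x'\<bar>" y y', OF _ DERIV_diff[OF deriv2 deriv2]] g assms
    by simp
qed

text \<open>The mixed second difference \<open>R\<close> over the rectangle with opposite corners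
  \<open>(x0, c)\<close> and \<open>p\<close> tends to 0 by \<open>increment_bound\<close>. What
  remains of \<open>f\<close> at \<open>p\<close> involves only its values on the lines y = c and x
  = x0, where one-variable continuity suffices.\<close>

lemma jointly_continuous: "continuous_on ({a..b} \<times> {c..d}) (\<lambda>(x, y). f x y)"
  unfolding continuous_on_def
proof safe
  fix x0 y0 assume x0: "x0 \<in> {a..b}" and y0: "y0 \<in> {c..d}"
  let ?F = "at (x0, y0) within {a..b} \<times> {c..d}"
  define R where "R = (\<lambda>p. (f (fst p) (snd p) - f x0 (snd p)) - (f (fst p) c - f x0 c))"
  have fst: "(fst \<longlongrightarrow> x0) ?F" and snd: "(snd \<longlongrightarrow> y0) ?F"
    using tendsto_fst[OF tendsto_ident_at] tendsto_snd[OF tendsto_ident_at] by fastforce+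
  have mem: "\<forall>\<^sub>F p in ?F. fst p \<in> {a..b} \<and> snd p \<in> {c..d}"
    by (auto simp: eventually_at_filter mem_Times_iff intro!: always_eventually)
  have "\<forall>\<^sub>F p in ?F. norm (R p) \<le> M * \<bar>fst p - x0\<bar> * \<bar>snd p - c\<bar>"
    using mem
  proof eventually_elim
    case (elim p)
    then show ?case
      using increment_bound[of "fst p" x0 "snd p" c] x0 cd by (simp add: R_def)
  qed
  moreover have "((\<lambda>p. M * \<bar>fst p - x0\<bar> * \<bar>snd p - c\<bar>) \<longlongrightarrow> 0) ?F"
    by (auto intro!: tendsto_eq_intros fst snd)
  ultimately have R: "(R \<longlongrightarrow> 0) ?F"
    by (rule Lim_null_comparison)
  have f1: "((\<lambda>p. f (fst p) c) \<longlongrightarrow> f x0 c) ?F"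
    by (rule continuous_on_tendsto_compose[OF cont1 fst x0])
      (use mem in \<open>rule eventually_mono; simp\<close>)
  have "continuous_on {c..d} (f x0)"
    using deriv2 x0 by (blast intro: DERIV_continuous_on)
  then have f2: "((\<lambda>p. f x0 (snd p)) \<longlongrightarrow> f x0 y0) ?F"
    by (rule continuous_on_tendsto_compose[OF _ snd y0])
      (use mem in \<open>rule eventually_mono; simp\<close>)
  have "((\<lambda>p. R p + (f (fst p) c - f x0 c) + f x0 (snd p)) \<longlongrightarrow>
      0 + (f x0 c - f x0 c) + f x0 y0) ?F"
    by (intro tendsto_intros R f1 f2)
  then show "((\<lambda>(x, y). f x y) \<longlongrightarrow> f x0 y0) ?F"
    by (simp add: R_def case_prod_beta')
qed

lemma continuous_1:
  assumes "y \<in> {c..d}"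
  shows "continuous_on {a..b} (\<lambda>x. f x y)"
proof -
  have "continuous_on {a..b} (\<lambda>x. case (x, y) of (x, y) \<Rightarrow> f x y)"
    using assms by (intro continuous_on_compose2[OF jointly_continuous] continuous_intros) auto
  then show ?thesis
    by simp
qed

lemma continuous_2: "x \<in> {a..b} \<Longrightarrow> continuous_on {c..d} (f x)"
  using deriv2 by (blast intro: DERIV_continuous_on)

text \<open>The theorem integrates over \<open>y\<close> first, the iterated error over
  \<open>x\<close> first.\<close>

lemma integral_swap_f:
  "integral {a..b} (\<lambda>x. integral {c..d} (f x)) =
   integral {c..d} (\<lambda>y. integral {a..b} (\<lambda>x. f x y))"
  using integral_swap_continuous[of a c b d f] jointly_continuous
  by (simp add: cbox_Pair_eq)

lemma deriv2_continuous_1: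
  "y \<in> {c..d} \<Longrightarrow> continuous_on {a..b} (\<lambda>x. g x y)"
  by (rule DERIV_continuous_on) (rule deriv12)

text \<open>The trapezoid error vanishes on constants, so \<open>\<phi> a\<close> may be
  subtracted.\<close>

lemma trapezoid_error_minus_left:
  assumes "continuous_on {a..b} \<phi>"
  shows "trapezoid_error a b \<phi> =
    (\<phi> b - \<phi> a) / 2 - 1 / (b - a) * integral {a..b} (\<lambda>x. \<phi> x - \<phi> a)"
proof -
  have "integral {a..b} (\<lambda>x. \<phi> x - \<phi> a) = integral {a..b} \<phi> - (b - a) * \<phi> a"
    using ab assms by (subst integral_diff) (auto intro: integrable_continuous_real)
  then show ?thesis
    using ab by (simp add: trapezoid_error_def field_simps)
qed

text \<open>
  Only the increments \<open>f x y - f a y\<close> have difference quotients in \<open>y\<close> with an evident uniform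
  bound; this is why the value at the left end is subtracted under the integral.
\<close>

lemma deriv_integral_increment:
  assumes y: "y \<in> {c..d}"
  shows "((\<lambda>y. integral {a..b} (\<lambda>x. f x y - f a y)) has_real_derivative
    integral {a..b} (\<lambda>x. g x y - g a y)) (at y within {c..d})"
  \<comment> \<open>Dominated convergence concerns sequences, so the difference quotient is tested
    along every sequence \<open>z\<close> in \<open>{c..d} - {y}\<close> tending to
    \<open>y\<close>.\<close>
  unfolding has_field_derivative_iff tendsto_at_iff_sequentially
proof safe
  fix z :: "nat \<Rightarrow> real"
  assume z: "\<forall>i. z i \<in> {c..d} - {y}" and lim: "z \<longlonglongrightarrow> y"
  define q where "q = (\<lambda>i x. ((f x (z i) - f a (z i)) - (f x y - f a y)) / (z i - y))"
  have zi: "z i \<in> {c..d}" "z i \<noteq> y" for i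
    using z by auto
  have int: "(\<lambda>x. f x s - f a s) integrable_on {a..b}" if "s \<in> {c..d}" for s
    by (intro integrable_continuous_real continuous_intros continuous_1 that)
  have M: "0 \<le> M"
    using bound[of a c] ab cd by force
  have lim_q: "(\<lambda>i. integral {a..b} (q i)) \<longlonglongrightarrow> integral {a..b} (\<lambda>x. g x y - g a y)"
  proof (rule dominated_convergence(2))
    show "q i integrable_on {a..b}" for i
      unfolding q_def by (intro integrable_on_divide integrable_diff[OF int int] y zi)
    show "(\<lambda>_. M * (b - a)) integrable_on {a..b}"
      by (rule integrable_const_ivl)
    show "norm (q i x) \<le> M * (b - a)" if "x \<in> {a..b}" for i x
    proof -
      have "\<bar>(f x (z i) - f a (z i)) - (f x y - f a y)\<bar> \<le> M * \<bar>x - a\<bar> * \<bar>z i - y\<bar>"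
        using that ab y zi by (intro increment_bound) auto
      also have "\<dots> \<le> M * (b - a) * \<bar>z i - y\<bar>"
        using that M by (intro mult_right_mono mult_left_mono) auto
      finally show ?thesis
        using zi[of i] by (simp add: q_def divide_le_eq)
    qed
    show "(\<lambda>i. q i x) \<longlonglongrightarrow> g x y - g a y" if "x \<in> {a..b}" for x
    proof -
      have "((\<lambda>y. f x y - f a y) has_real_derivative g x y - g a y) (at y within {c..d})"
        using that ab y by (intro derivative_intros deriv2) auto
      then show ?thesis
        using z lim unfolding has_field_derivative_iff tendsto_at_iff_sequentially
        by (auto simp: q_def comp_def)
    qed
  qed
  have "integral {a..b} (q i) = (integral {a..b} (\<lambda>x. f x (z i) - f a (z i)) -
      integral {a..b} (\<lambda>x. f x y - f a y)) / (z i - y)" for i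
    unfolding q_def using int[OF zi(1)[of i]] int[OF y] by (simp add: integral_diff)
  with lim_q show "((\<lambda>s. (integral {a..b} (\<lambda>x. f x s - f a s) -
      integral {a..b} (\<lambda>x. f x y - f a y)) / (s - y)) \<circ> z)
    \<longlonglongrightarrow> integral {a..b} (\<lambda>x. g x y - g a y)"
    by (simp add: comp_def)
qed

lemma deriv_trapezoid_error:
  assumes y: "y \<in> {c..d}"
  shows "((\<lambda>y. trapezoid_error a b (\<lambda>x. f x y)) has_real_derivative
    trapezoid_error a b (\<lambda>x. g x y)) (at y within {c..d})"
proof -
  have "((\<lambda>y. (f b y - f a y) / 2 - 1 / (b - a) * integral {a..b} (\<lambda>x. f x y - f a y))
    has_real_derivative
      (g b y - g a y) / 2 - 1 / (b - a) * integral {a..b} (\<lambda>x. g x y - g a y)) (at y within {c..d})"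
    using ab y by (intro DERIV_diff DERIV_cdivide DERIV_cmult deriv2 deriv_integral_increment) auto
  then show ?thesis
    unfolding trapezoid_error_minus_left[OF deriv2_continuous_1[OF y]]
    \<comment> \<open>The two forms of the error agree on all of \<open>{c..d}\<close>, so the
      radius 1 is an arbitrary choice.\<close>
    by (rule has_field_derivative_transform_within[OF _ zero_less_one y])
      (simp add: trapezoid_error_minus_left[OF continuous_1])
qed

lemma iterated_trapezoid_error:
  "trapezoid_error c d (\<lambda>y. trapezoid_error a b (\<lambda>x. f x y)) =
    (f a c + f a d + f b c + f b d) / 4
    + 1 / ((b - a) * (d - c)) * integral {a..b} (\<lambda>x. integral {c..d} (f x))
    - 1 / 2 * (1 / (b - a) * integral {a..b} (\<lambda>x. f x c + f x d)
       + 1 / (d - c) * integral {c..d} (\<lambda>y. f a y + f b y))"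
proof -
  define I where "I = (\<lambda>y. integral {a..b} (\<lambda>x. f x y))"
  have f2: "f a integrable_on {c..d}" "f b integrable_on {c..d}"
    using ab by (auto intro!: integrable_continuous_real continuous_2)
  have f1: "(\<lambda>x. f x c) integrable_on {a..b}" "(\<lambda>x. f x d) integrable_on {a..b}"
    using cd by (auto intro!: integrable_continuous_real continuous_1)
  have "continuous_on {c..d} (\<lambda>y. trapezoid_error a b (\<lambda>x. f x y))"
    by (rule DERIV_continuous_on) (rule deriv_trapezoid_error)
  \<comment> \<open>Solving the definition of the inner error for its integral expresses
    \<open>I\<close> through functions already known to be continuous in \<open>y\<close>.\<close>
  then have "continuous_on {c..d}
      (\<lambda>y. (b - a) * ((f a y + f b y) / 2 - trapezoid_error a b (\<lambda>x. f x y)))"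
    using ab by (intro continuous_intros continuous_2) auto
  then have "continuous_on {c..d} I"
    using ab by (simp add: trapezoid_error_def I_def)
  then have I: "I integrable_on {c..d}"
    by (rule integrable_continuous_real)
  have "integral {c..d} (\<lambda>y. trapezoid_error a b (\<lambda>x. f x y)) =
      integral {c..d} (\<lambda>y. (f a y + f b y) / 2) - integral {c..d} (\<lambda>y. 1 / (b - a) * I y)"
    unfolding trapezoid_error_def I_def[THEN fun_cong, symmetric]
    by (intro integral_diff integrable_on_divide integrable_add f2
        integrable_on_mult_right I)
  also have "\<dots> = integral {c..d} (\<lambda>y. f a y + f b y) / 2 - 1 / (b - a) * integral {c..d} I"
    by simp
  finally have eq: "integral {c..d} (\<lambda>y. trapezoid_error a b (\<lambda>x. f x y)) =
      integral {c..d} (\<lambda>y. f a y + f b y) / 2 - 1 / (b - a) * integral {c..d} I" .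
  have sum: "integral {a..b} (\<lambda>x. f x c + f x d) = I c + I d"
    unfolding I_def using f1 by (rule integral_add)
  show ?thesis
    unfolding trapezoid_error_def[of c d] eq integral_swap_f sum I_def[symmetric]
    unfolding trapezoid_error_def I_def[THEN fun_cong, symmetric]
    by (simp add: algebra_simps add_divide_distrib diff_divide_distrib)
qed

end

section \<open>Coordinated convexity and the estimate on the rectangle\<close>

lemma coord_convex_on_left:
  assumes "coord_convex_on {a..b} J k" "a < b" "x \<in> {a..b}" "y \<in> J"
  shows "k (x, y) \<le> ((b - x) * k (a, y) + (x - a) * k (b, y)) / (b - a)"
proof -
  \<comment> \<open>With \<open>s = 1\<close> and \<open>u = v = y\<close>, coordinated convexity
    becomes convexity in the first variable; this weight gives
    \<open>x = t * a + (1 - t) * b\<close>.\<close>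
  define t where "t = (b - x) / (b - a)"
  have t: "t \<in> {0..1}" "1 - t = (x - a) / (b - a)" "t * a + (1 - t) * b = x"
    using assms by (auto simp: t_def divide_simps) (simp add: algebra_simps)
  have "k (t * a + (1 - t) * b, 1 * y + (1 - 1) * y) \<le>
      t * 1 * k (a, y) + 1 * (1 - t) * k (b, y)
      + t * (1 - 1) * k (a, y) + (1 - t) * (1 - 1) * k (b, y)"
    using assms(1)[unfolded coord_convex_on_def, rule_format, of t 1 a b y y] t(1) assms(2-4)
    by simp
  then show ?thesis
    unfolding t(3) unfolding t(2) by (simp add: t_def add_divide_distrib)
qed

lemma coord_convex_on_right:
  assumes "coord_convex_on I {c..d} k" "c < d" "x \<in> I" "y \<in> {c..d}"
  shows "k (x, y) \<le> ((d - y) * k (x, c) + (y - c) * k (x, d)) / (d - c)"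
proof -
  define s where "s = (d - y) / (d - c)"
  have s: "s \<in> {0..1}" "1 - s = (y - c) / (d - c)" "s * c + (1 - s) * d = y"
    using assms by (auto simp: s_def divide_simps) (simp add: algebra_simps)
  have "k (1 * x + (1 - 1) * x, s * c + (1 - s) * d) \<le>
      1 * s * k (x, c) + s * (1 - 1) * k (x, c)
      + 1 * (1 - s) * k (x, d) + (1 - 1) * (1 - s) * k (x, d)"
    using assms(1)[unfolded coord_convex_on_def, rule_format, of 1 s x x c d] s(1) assms(2-4)
    by simp
  then show ?thesis
    unfolding s(3) unfolding s(2) by (simp add: s_def add_divide_distrib)
qed

text \<open>A crude bound, sufficient for \<open>M\<close>, which serves regularity and does not
  enter the final constant.\<close>

lemma interpolation_le_sum:
  fixes a b x p q :: real
  assumes "a < b" "x \<in> {a..b}" "0 \<le> p" "0 \<le> q"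
  shows "((b - x) * p + (x - a) * q) / (b - a) \<le> p + q"
proof -
  have "(b - x) * p + (x - a) * q \<le> (b - a) * p + (b - a) * q"
    using assms by (intro add_mono mult_right_mono) auto
  then show ?thesis
    using assms(1) by (simp add: divide_le_eq algebra_simps)
qed

theorem theorem2:
  fixes a b c d :: real and f :: "real \<times> real \<Rightarrow> real"
  assumes "a < b" and "c < d"
    and "partial_differentiable_on {a..b} {c..d} f"
    and "coord_convex_on {a..b} {c..d} (\<lambda>p. \<bar>mixed_partial {a..b} {c..d} f p\<bar>)"
  defines "A \<equiv> 1 / 2 *
      (1 / (b - a) * integral {a..b} (\<lambda>x. f (x, c) + f (x, d))
       + 1 / (d - c) * integral {c..d} (\<lambda>y. f (a, y) + f (b, y)))"
  shows "\<bar>(f (a, c) + f (a, d) + f (b, c) + f (b, d)) / 4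
          + 1 / ((b - a) * (d - c)) * integral {a..b} (\<lambda>x. integral {c..d} (\<lambda>y. f (x, y)))
          - A\<bar>
      \<le> (b - a) * (d - c) / 16 *
        ((\<bar>mixed_partial {a..b} {c..d} f (a, c)\<bar> + \<bar>mixed_partial {a..b} {c..d} f (a, d)\<bar>
          + \<bar>mixed_partial {a..b} {c..d} f (b, c)\<bar> + \<bar>mixed_partial {a..b} {c..d} f (b, d)\<bar>) / 4)"
proof -
  define h where "h = mixed_partial {a..b} {c..d} f"
  define g where "g = partial2 {c..d} f"
  define M where "M = (\<bar>h (a, c)\<bar> + \<bar>h (a, d)\<bar>) + (\<bar>h (b, c)\<bar> + \<bar>h (b, d)\<bar>)"
  note convex = assms(4)[folded h_def]
  have left: "\<bar>h (x, y)\<bar> \<le> ((b - x) * \<bar>h (a, y)\<bar> + (x - a) * \<bar>h (b, y)\<bar>) / (b - a)"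
    if "x \<in> {a..b}" "y \<in> {c..d}" for x y
    using coord_convex_on_left[OF convex assms(1) that] .
  have right: "\<bar>h (x, y)\<bar> \<le> ((d - y) * \<bar>h (x, c)\<bar> + (y - c) * \<bar>h (x, d)\<bar>) / (d - c)"
    if "x \<in> {a..b}" "y \<in> {c..d}" for x y
    using coord_convex_on_right[OF convex assms(2) that] .
  have right': "\<bar>h (x, y)\<bar> \<le> \<bar>h (x, c)\<bar> + \<bar>h (x, d)\<bar>"
    if "x \<in> {a..b}" "y \<in> {c..d}" for x y
    using right[OF that] interpolation_le_sum[OF assms(2) that(2)] by (rule order_trans) auto
  interpret bounded_mixed_derivative a b c d M "\<lambda>x y. f (x, y)" "\<lambda>x y. g (x, y)" "\<lambda>x y. h (x, y)"
  proof
    show "continuous_on {a..b} (\<lambda>x. f (x, c))"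
      using assms(2,3) differentiable_imp_continuous_within
      by (fastforce simp: partial_differentiable_on_def partial1_exists_on_def
          continuous_on_eq_continuous_within)
    show "((\<lambda>y. f (x, y)) has_real_derivative g (x, y)) (at y within {c..d})"
      if "x \<in> {a..b}" "y \<in> {c..d}" for x y
      using assms(3) that
      by (auto simp: partial_differentiable_on_def partial2_exists_on_def g_def partial2_def
          has_real_derivative_iff_has_vector_derivative vector_derivative_works[symmetric])
    show "((\<lambda>t. g (t, y)) has_real_derivative h (x, y)) (at x within {a..b})"
      if "x \<in> {a..b}" "y \<in> {c..d}" for x y
      using assms(3) that unfolding h_def mixed_partial_def g_def[symmetric]
      by (auto simp: partial_differentiable_on_def partial1_exists_on_def g_def[symmetric]
          partial1_def has_real_derivative_iff_has_vector_derivative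
          vector_derivative_works[symmetric])
    show "\<bar>h (x, y)\<bar> \<le> M" if "x \<in> {a..b}" "y \<in> {c..d}" for x y
    proof -
      have "\<bar>h (x, y)\<bar> \<le> \<bar>h (a, y)\<bar> + \<bar>h (b, y)\<bar>"
        using left[OF that] interpolation_le_sum[OF assms(1) that(1)] by (rule order_trans) auto
      also have "\<dots> \<le> M"
        unfolding M_def using that assms(1) by (intro add_mono right') auto
      finally show ?thesis .
    qed
  qed (use assms in auto)
  \<comment> \<open>\<open>P\<close> and \<open>Q\<close> bound the derivative of the inner error at
    y = c and y = d. Inserting \<open>right\<close> turns the bound at a general \<open>y\<close>
    into their linear interpolant, the form that \<open>trapezoid_error_le\<close> requires.\<close>
  define P where "P = (b - a) / 8 * (\<bar>h (a, c)\<bar> + \<bar>h (b, c)\<bar>)"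
  define Q where "Q = (b - a) / 8 * (\<bar>h (a, d)\<bar> + \<bar>h (b, d)\<bar>)"
  have "\<bar>trapezoid_error c d (\<lambda>y. trapezoid_error a b (\<lambda>x. f (x, y)))\<bar> \<le> (d - c) / 8 * (P + Q)"
  proof (rule trapezoid_error_le[OF cd deriv_trapezoid_error])
    fix y assume y: "y \<in> {c..d}"
    have "\<bar>trapezoid_error a b (\<lambda>x. g (x, y))\<bar> \<le> (b - a) / 8 * (\<bar>h (a, y)\<bar> + \<bar>h (b, y)\<bar>)"
      using ab y by (intro trapezoid_error_le[OF _ deriv12] left) auto
    also have "\<dots> \<le> (b - a) / 8 * (((d - y) * \<bar>h (a, c)\<bar> + (y - c) * \<bar>h (a, d)\<bar>) / (d - c)
        + ((d - y) * \<bar>h (b, c)\<bar> + (y - c) * \<bar>h (b, d)\<bar>) / (d - c))"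
      using ab y by (intro mult_left_mono add_mono right) auto
    also have "\<dots> = ((d - y) * P + (y - c) * Q) / (d - c)"
      unfolding P_def Q_def using cd by (simp add: divide_simps) algebra
    finally show "\<bar>trapezoid_error a b (\<lambda>x. g (x, y))\<bar> \<le> ((d - y) * P + (y - c) * Q) / (d - c)" .
  qed
  \<comment> \<open>Each variable contributes a factor 1/8, and 1/64 = (1/16)(1/4).\<close>
  also have "(d - c) / 8 * (P + Q) = (b - a) * (d - c) / 16 *
      ((\<bar>h (a, c)\<bar> + \<bar>h (a, d)\<bar> + \<bar>h (b, c)\<bar> + \<bar>h (b, d)\<bar>) / 4)"
    by (simp add: P_def Q_def field_simps)
  finally show ?thesis
    unfolding iterated_trapezoid_error A_def h_def .
qed

end
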